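(* Let $M$ be a compact metric space, $f\colon M\to M$ a continuous map, $X=(X,\lVert\cdot\rVert)$ a separable Banach space, and $\mathcal{A}\colon M\times\mathbb{N}_0\to B(X)$ a cocycle over $f$. Assume that $\lambda_\mu(\mathcal{A})<0$ for some ergodic $f$-invariant Borel probability measure $\mu$ on $M$, where $\lambda_\mu(\mathcal{A})\in[-\infty,\infty)$ is the largest Lyapunov exponent of $\mathcal{A}$ with respect to $\mu$. Then for each $\varepsilon>0$ there exists a measurable function $T\colon M\to(0,\infty)$ such that: (1) for $\mu$-a.e. $q\in M$ and $n\in\mathbb{N}_0$, \[ \lVert\mathcal{A}(q,n)\rVert\le T(q)e^{(\lambda_\mu(\mathcal{A})+\varepsilon)n}; \] (2) for $\mu$-a.e. $q\in M$ and $n\in\mathbb{N}_0$, \[ T(f^n(q))\le T(q)e^{\varepsilon n}. \]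
   Context: $\mathbb{N}_0=\{0,1,2,\ldots\}$ and $B(X)$ is the space of all bounded linear operators on $X$. A map $\mathcal{A}\colon M\times\mathbb{N}_0\to B(X)$ is a cocycle over $f$ if: (i) $\mathcal{A}(q,0)=\mathrm{Id}$ for each $q\in M$; (ii) $\mathcal{A}(q,n+m)=\mathcal{A}(f^m(q),n)\mathcal{A}(q,m)$ for each $q\in M$ and $n,m\in\mathbb{N}_0$; (iii) the map $A\colon M\to B(X)$, $A(q)=\mathcal{A}(q,1)$ (the generator of $\mathcal{A}$), is strongly continuous, i.e. $q\mapsto A(q)x$ is continuous for each $x\in X$. Under these assumptions $q\mapsto\lVert\mathcal{A}(q,n)\rVert$ is Borel-measurable for each $n$ and $\sup_{q\in M}\lVert A(q)\rVert<\infty$, so by Kingman's subadditive ergodic theorem, for each ergodic $f$-invariant Borel probability measure $\mu$ there is $\lambda_\mu(\mathcal{A})\in[-\infty,\infty)$ with \[ \lambda_\mu(\mathcal{A})=\lim_{n\to\infty}\frac1n\log\lVert\mathcal{A}(q,n)\rVert\quad\text{for }\mu\text{-a.e. }q\in M \] (convention $\log 0=-\infty$). It is called the largest Lyapunov exponent of $\mathcal{A}$ with respect to $\mu$.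
   Formalization: When the largest Lyapunov exponent is −∞, the bound (1) as written would force the cocycle to vanish for n ≥ 1 and is false in general; there the rate λ+ε is replaced by an arbitrary real number L, and T may depend on L. For finite λ the claim is unchanged. *)

theory Defs
  imports "HOL-Probability.Probability"
begin

definition cocycle ::
  "('m::topological_space \<Rightarrow> 'm) \<Rightarrow> ('m \<Rightarrow> nat \<Rightarrow> 'x::real_normed_vector \<Rightarrow>\<^sub>L 'x) \<Rightarrow> bool"
  where
  "cocycle f A \<longleftrightarrow>
     (\<forall>q. A q 0 = id_blinfun) \<and>
     (\<forall>q n m. A q (n + m) = A ((f ^^ m) q) n o\<^sub>L A q m) \<and>
     (\<forall>x. continuous_on UNIV (\<lambda>q. blinfun_apply (A q 1) x))"

definition ergodic_invariant ::
  "('m::topological_space \<Rightarrow> 'm) \<Rightarrow> 'm measure \<Rightarrow> bool" where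
  "ergodic_invariant f \<mu> \<longleftrightarrow>
     f \<in> \<mu> \<rightarrow>\<^sub>M \<mu> \<and> distr \<mu> \<mu> f = \<mu> \<and>
     (\<forall>B\<in>sets \<mu>. f -` B \<inter> space \<mu> = B \<longrightarrow> measure \<mu> B = 0 \<or> measure \<mu> B = 1)"

text \<open>Extended logarithm of a nonnegative real, with the convention that the logarithm of
  zero is minus infinity.\<close>

definition ext_ln :: "real \<Rightarrow> ereal" where
  "ext_ln x = (if x = 0 then - \<infinity> else ereal (ln x))"

text \<open>The largest Lyapunov exponent is the almost everywhere constant limit, a number in
  \<open>[-\<infinity>, \<infinity>)\<close>. It is rendered as a relation between the data and the value; the value
  is unique when \<open>\<mu>\<close> is a probability measure.\<close>

definition has_largest_lyapunov_exponent ::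
  "'m measure \<Rightarrow> ('m \<Rightarrow> nat \<Rightarrow> 'x::real_normed_vector \<Rightarrow>\<^sub>L 'x) \<Rightarrow> ereal \<Rightarrow> bool" where
  "has_largest_lyapunov_exponent \<mu> A l \<longleftrightarrow>
     l < \<infinity> \<and>
     (AE q in \<mu>. (\<lambda>n. ereal (1 / real n) * ext_ln (norm (A q n))) \<longlonglongrightarrow> l)"

end

theory Submission
  imports Defs
begin

text \<open>The function \<open>T(q)\<close> is the supremum over all \<open>m\<close>, \<open>n\<close> of
  \<open>norm (A (f^m q) n) * exp (- L n - \<epsilon> m)\<close>, for which both estimates are immediate; the point is
  that it is finite almost everywhere. Let \<open>B\<close> be the set where
  \<open>norm (A q n) \<le> exp (K + L n)\<close> for all \<open>n\<close>; as \<open>K\<close> grows these sets exhaust almost all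
  of the space. The generator being bounded, a point that reaches \<open>B\<close> after \<open>j\<close> steps
  satisfies this estimate with \<open>K + C j\<close> in place of \<open>K\<close>, so it suffices that the waiting time
  for the next visit to \<open>B\<close> grows at most like a small multiple of the elapsed time. The
  return time to \<open>B\<close> is integrable over \<open>B\<close> (Kac), so this follows from Borel-Cantelli. No
  ergodic theorem is needed.\<close>

section \<open>Uniform boundedness principle\<close>

lemma uniform_boundedness:
  fixes F :: "'i \<Rightarrow> 'x::banach \<Rightarrow>\<^sub>L 'y::real_normed_vector"
  assumes pointwise: "\<And>x. bounded (range (\<lambda>i. F i x))"
  shows "bounded (range F)"
proof -
  \<comment> \<open>Baire category: these closed sets cover the space, so one of them contains a
    closed ball around some \<open>x0\<close>.\<close>
  define S where "S k = {x. \<forall>i. norm (F i x) \<le> real k}" for k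
  have S_closed: "closed (S k)" for k
  proof -
    have "S k = (\<Inter>i. {x. norm (F i x) \<le> real k})" by (auto simp: S_def)
    also have "closed \<dots>"
      by (intro closed_INT ballI closed_Collect_le continuous_intros)
    finally show ?thesis .
  qed
  have "(\<Union>k. S k) = UNIV"
  proof -
    have "\<exists>k. x \<in> S k" for x
    proof -
      obtain B where B: "\<And>i. norm (F i x) \<le> B"
        using pointwise[of x] by (auto simp: bounded_iff)
      obtain k :: nat where "B \<le> real k" using real_arch_simple by blast
      then show ?thesis using B by (auto simp: S_def intro!: exI[of _ k] order_trans[OF B])
    qed
    then show ?thesis by auto
  qed
  moreover have "interior (\<Union>k. S k) = {}" if "\<And>k. interior (S k) = {}"
    using Met_TC.metric_Baire_category_alt[of "range S"] S_closed that
    by (auto simp: complete_UNIV)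
  ultimately obtain k where "interior (S k) \<noteq> {}"
    by fastforce
  then obtain x0 e where e: "e > 0" "cball x0 e \<subseteq> S k"
    by (metis ex_in_conv mem_interior_cball)
  have "norm (F i) \<le> 2 * real k / e" for i
  proof (rule norm_blinfun_bound)
    show "0 \<le> 2 * real k / e" using e by simp
    fix x
    show "norm (F i x) \<le> 2 * real k / e * norm x"
    proof (cases "x = 0")
      case False
      \<comment> \<open>Scaling \<open>x\<close> to length \<open>e\<close> keeps
        \<open>x0 + y\<close> in the ball. Then \<open>F i y\<close> is a difference of two vectors
        of norm at most \<open>k\<close>, whence the factor 2.\<close>
      define y where "y = (e / norm x) *\<^sub>R x"
      have "x0 + y \<in> S k" "x0 \<in> S k"
        using e False by (auto simp: y_def dist_norm intro!: subsetD[OF e(2)])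
      then have "norm (F i (x0 + y)) \<le> k" "norm (F i x0) \<le> k"
        by (auto simp: S_def)
      moreover have "F i y = F i (x0 + y) - F i x0"
        by (simp add: blinfun.add_right)
      ultimately have "norm (F i y) \<le> 2 * real k"
        using norm_triangle_ineq4[of "F i (x0 + y)" "F i x0"] by simp
      then show ?thesis
        using e False by (simp add: y_def blinfun.scaleR_right field_simps)
    qed simp
  qed
  then show ?thesis by (auto simp: bounded_iff)
qed

section \<open>Return times of measure-preserving maps\<close>

lemma distr_funpow:
  assumes f: "f \<in> M \<rightarrow>\<^sub>M M" and inv: "distr M M f = M"
  shows "distr M M (f ^^ k) = M"
proof (induction k)
  case 0
  show ?case by (simp add: id_def)
next
  case (Suc k)
  have "distr M M (f \<circ> (f ^^ k)) = distr (distr M M (f ^^ k)) M f"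
    using f by (intro distr_distr[symmetric] measurable_compose_n)
  with Suc inv show ?case by (simp add: o_def)
qed

text \<open>The tail event "first return time to \<open>B\<close> exceeds \<open>n\<close>", taken
  inside \<open>B\<close>; infinite return times are included.\<close>

definition no_return :: "('a \<Rightarrow> 'a) \<Rightarrow> 'a set \<Rightarrow> nat \<Rightarrow> 'a set" where
  "no_return f B n = {q \<in> B. \<forall>j\<in>{1..n}. (f ^^ j) q \<notin> B}"

lemma no_return_sets:
  assumes f [measurable]: "f \<in> M \<rightarrow>\<^sub>M M" and B [measurable]: "B \<in> sets M"
  shows "no_return f B n \<in> sets M"
proof -
  have "no_return f B n = {q \<in> space M. q \<in> B \<and> (\<forall>j\<in>{1..n}. (f ^^ j) q \<notin> B)}"
    using sets.sets_into_space[OF B] by (auto simp: no_return_def)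
  also have "\<dots> \<in> sets M"
    using measurable_compose_n[OF f] by measurable
  finally show ?thesis .
qed

text \<open>The upper bound in Kac's lemma: the series is the integral over \<open>B\<close> of the
  first return time. Invariance turns each partial sum into the measure of a disjoint union, hence
  the bound 1.\<close>

lemma (in prob_space) summable_no_return:
  assumes f: "f \<in> M \<rightarrow>\<^sub>M M" and inv: "distr M M f = M" and B: "B \<in> sets M"
  shows "summable (\<lambda>n. prob (no_return f B n))"
proof (rule bounded_imp_summable)
  fix N
  text \<open>\<open>last_visit n\<close> is the set of points whose last visit to \<open>B\<close> up to time \<open>N\<close>
    takes place at time \<open>N - n\<close>; it is a preimage of \<open>no_return f B n\<close>.\<close>
  define last_visit where "last_visit n = (f ^^ (N - n)) -` no_return f B n \<inter> space M" for n
  have fpow: "f ^^ k \<in> M \<rightarrow>\<^sub>M M" for k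
    using f by (rule measurable_compose_n)
  have sets: "last_visit n \<in> sets M" for n
    unfolding last_visit_def by (intro measurable_sets[OF fpow] no_return_sets f B)
  have "prob (last_visit n) = prob (no_return f B n)" for n
    using measure_distr[OF fpow no_return_sets[OF f B], of "N - n" n]
    by (simp add: last_visit_def distr_funpow[OF f inv])
  then have "(\<Sum>n\<le>N. prob (no_return f B n)) = (\<Sum>n\<le>N. prob (last_visit n))"
    by simp
  also have "\<dots> = prob (\<Union>n\<le>N. last_visit n)"
  proof (rule finite_measure_finite_Union[symmetric])
    \<comment> \<open>A visit at time \<open>N - m\<close> would fall among the \<open>n\<close>
      steps after time \<open>N - n\<close> that avoid \<open>B\<close>.\<close>
    have False if "m < n" "n \<le> N" "q \<in> last_visit m" "q \<in> last_visit n" for m n q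
    proof -
      have "(f ^^ (n - m)) ((f ^^ (N - n)) q) \<notin> B"
        using that by (auto simp: last_visit_def no_return_def)
      moreover have "(f ^^ (n - m)) ((f ^^ (N - n)) q) = (f ^^ (N - m)) q"
        using that by (simp flip: funpow_add[THEN fun_cong, unfolded o_apply])
      ultimately show False
        using that by (auto simp: last_visit_def no_return_def)
    qed
    then show "disjoint_family_on last_visit {..N}"
      unfolding disjoint_family_on_def by (metis atMost_iff disjoint_iff linorder_neqE_nat)
  qed (use sets in auto)
  also have "\<dots> \<le> 1" by (rule prob_le_1)
  finally show "(\<Sum>n\<le>N. prob (no_return f B n)) \<le> 1" .
qed simp

text \<open>Each value of \<open>p\<close> is repeated \<open>k\<close> times. This makes
  Borel-Cantelli applicable to waits longer than \<open>n div k\<close> at time \<open>n\<close>, a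
  linear rate as small as desired.\<close>

lemma summable_div:
  fixes p :: "nat \<Rightarrow> real"
  assumes "summable p" "\<And>n. 0 \<le> p n" "0 < k"
  shows "summable (\<lambda>n. p (n div k))"
proof (rule summableI_nonneg_bounded)
  fix N
  have "(\<Sum>n<N. p (n div k)) \<le> (\<Sum>n<N * k. p (n div k))"
    using assms by (intro sum_mono2) auto
  also have "\<dots> = (\<Sum>m<N. \<Sum>n=m*k..<m*k+k. p (n div k))"
    by (rule sum.nat_group[symmetric])
  also have "\<dots> = (\<Sum>m<N. real k * p m)"
  proof (rule sum.cong[OF refl])
    fix m
    have "(\<Sum>n=m*k..<m*k+k. p (n div k)) = (\<Sum>n=m*k..<m*k+k. p m)"
    proof (intro sum.cong refl arg_cong[of _ _ p])
      fix n assume "n \<in> {m*k..<m*k+k}"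
      then show "n div k = m"
        by (intro div_nat_eqI) (auto simp: algebra_simps)
    qed
    then show "(\<Sum>n=m*k..<m*k+k. p (n div k)) = real k * p m" by simp
  qed
  also have "\<dots> \<le> real k * suminf p"
    using assms by (simp add: sum_distrib_left[symmetric] sum_le_suminf mult_left_mono)
  finally show "(\<Sum>n<N. p (n div k)) \<le> real k * suminf p" .
qed (use assms in auto)

text \<open>Visits at time \<open>n\<close> followed by no return within \<open>n div k\<close>
  steps have summable probabilities, so almost every point has finitely many of them;
  \<open>c\<close> pays for these exceptions.\<close>

lemma (in prob_space) AE_sublinear_return:
  assumes f: "f \<in> M \<rightarrow>\<^sub>M M" and inv: "distr M M f = M" and B: "B \<in> sets M" and k: "0 < k"
  shows "AE q in M. q \<in> B \<longrightarrow> (\<exists>c. \<forall>n. \<exists>j \<le> c + n div k. (f ^^ (n + j)) q \<in> B)"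
proof -
  let ?D = "no_return f B"
  have fpow: "f ^^ n \<in> M \<rightarrow>\<^sub>M M" for n
    using f by (rule measurable_compose_n)
  have D: "?D n \<in> sets M" for n by (rule no_return_sets[OF f B])
  have summ: "summable (\<lambda>n. prob (?D n))" by (rule summable_no_return[OF f inv B])
  define E where "E n = (f ^^ n) -` ?D (n div k) \<inter> space M" for n
  have probE: "prob ((f ^^ n) -` ?D m \<inter> space M) = prob (?D m)" for n m
    using measure_distr[OF fpow D, of n m] by (simp add: distr_funpow[OF f inv])
  have ev: "AE q in M. eventually (\<lambda>n. q \<in> space M - E n) sequentially"
  proof (rule borel_cantelli_AE1)
    show "E n \<in> sets M" for n unfolding E_def by (rule measurable_sets[OF fpow D])
    show "summable (\<lambda>n. prob (E n))"
      unfolding E_def probE by (intro summable_div summ k) simp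
  qed (simp add: emeasure_eq_measure)
  \<comment> \<open>The exceptional visits need a finite wait too: for fixed \<open>n\<close>,
    Borel-Cantelli in \<open>m\<close> gives some return almost surely.\<close>
  have ret: "AE q in M. \<exists>m. (f ^^ n) q \<notin> ?D m" for n
  proof -
    have "AE q in M. eventually (\<lambda>m. q \<in> space M - ((f ^^ n) -` ?D m \<inter> space M)) sequentially"
    proof (rule borel_cantelli_AE1)
      show "(f ^^ n) -` ?D m \<inter> space M \<in> sets M" for m by (rule measurable_sets[OF fpow D])
      show "summable (\<lambda>m. prob ((f ^^ n) -` ?D m \<inter> space M))"
        unfolding probE by (rule summ)
    qed (simp add: emeasure_eq_measure)
    then show ?thesis
      by eventually_elim (force simp: eventually_sequentially)
  qed
  have "AE q in M. \<forall>n. \<exists>m. (f ^^ n) q \<notin> ?D m" using ret by (simp add: AE_all_countable)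
  with ev show ?thesis
  proof eventually_elim
    case (elim q)
    show ?case
    proof
      assume "q \<in> B"
      obtain n0 where n0: "(f ^^ n) q \<notin> ?D (n div k)" if "n \<ge> n0" for n
        using elim(1) by (auto simp: eventually_sequentially E_def)
      obtain r where r: "\<And>n. (f ^^ n) q \<notin> ?D (r n)" using elim(2) by metis
      define c where "c = (\<Sum>n<n0. r n)"
      \<comment> \<open>The sum \<open>c\<close> dominates every wait \<open>r n\<close> with
        \<open>n < n0\<close>. The new visit is strictly later, as the induction below requires when
        \<open>n\<close> itself is a visit.\<close>
      have next_visit: "\<exists>j\<in>{1..c + n div k}. (f ^^ (n + j)) q \<in> B" if "(f ^^ n) q \<in> B" for n
      proof -
        have "\<exists>m \<le> c + n div k. (f ^^ n) q \<notin> ?D m"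
        proof (cases "n < n0")
          case True
          then have "r n \<le> c" unfolding c_def by (intro member_le_sum) auto
          then show ?thesis using r by (meson trans_le_add1)
        qed (use n0 in \<open>auto intro!: exI[of _ "n div k"]\<close>)
        then show ?thesis
          using that by (force simp: no_return_def funpow_add add.commute[of n])
      qed
      \<comment> \<open>A visit \<open>j\<close> steps ahead of time \<open>n\<close> is
        \<open>j - 1\<close> steps ahead of \<open>Suc n\<close>; if \<open>j = 0\<close>,
        \<open>next_visit\<close> supplies another one.\<close>
      have "\<exists>j \<le> c + n div k. (f ^^ (n + j)) q \<in> B" for n
      proof (induction n)
        case 0
        then show ?case using \<open>q \<in> B\<close> by (intro exI[of _ 0]) simp
      next
        case (Suc n)
        then obtain j where j: "j \<le> c + n div k" "(f ^^ (n + j)) q \<in> B" by blast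
        obtain i where i: "1 \<le> i" "i \<le> c + n div k" "(f ^^ (n + i)) q \<in> B"
        proof (cases "j = 0")
          case True
          then show ?thesis using next_visit[of n] j that by auto
        qed (use j that[of j] in auto)
        have "n div k \<le> Suc n div k" by (rule div_le_mono) simp
        with i(2) have "i - 1 \<le> c + Suc n div k" by linarith
        with i show ?case
          by (intro exI[of _ "i - 1"]) simp
      qed
      then show "\<exists>c. \<forall>n. \<exists>j \<le> c + n div k. (f ^^ (n + j)) q \<in> B" by blast
    qed
  qed
qed

section \<open>Cocycles: bounds, continuity and measurability\<close>

lemma cocycle_add:
  "cocycle f A \<Longrightarrow> A q (n + m) = A ((f ^^ m) q) n o\<^sub>L A q m"
  by (simp add: cocycle_def)

text \<open>Strong continuity and compactness bound each orbit of vectors \<open>A q 1 x\<close>;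
  uniform boundedness then bounds the norms. Taking \<open>a\<close> at least 1 keeps its logarithm
  meaningful later.\<close>

lemma cocycle_generator_bounded:
  fixes A :: "'m::metric_space \<Rightarrow> nat \<Rightarrow> 'x::banach \<Rightarrow>\<^sub>L 'x"
  assumes "compact (UNIV :: 'm set)" "cocycle f A"
  obtains a where "1 \<le> a" "\<And>q. norm (A q 1) \<le> a"
proof -
  have "bounded (range (\<lambda>q. A q 1 x))" for x
    using assms by (intro compact_imp_bounded compact_continuous_image) (auto simp: cocycle_def)
  from uniform_boundedness[of "\<lambda>q. A q 1", OF this]
  obtain a where "\<And>q. norm (A q 1) \<le> a" by (auto simp: bounded_iff)
  then show ?thesis by (intro that[of "max 1 a"]) (auto simp: le_max_iff_disj)
qed

lemma cocycle_norm_le_power: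
  assumes "cocycle f A" "0 \<le> a" "\<And>q. norm (A q 1) \<le> a"
  shows "norm (A q n) \<le> a ^ n"
proof (induction n)
  case 0
  then show ?case using assms by (simp add: cocycle_def norm_blinfun_id_le)
next
  case (Suc n)
  have "norm (A q (1 + n)) \<le> norm (A ((f ^^ n) q) 1) * norm (A q n)"
    unfolding cocycle_add[OF assms(1)] by (rule norm_blinfun_compose)
  also have "\<dots> \<le> a * a ^ n" using assms Suc by (intro mult_mono) auto
  finally show ?case by simp
qed

text \<open>Products of strongly continuous families need a uniform norm bound: the change in the
  inner vector is damped by \<open>a\<close>, while with that vector frozen the generator varies
  continuously along \<open>f ^^ n\<close>.\<close>

lemma cocycle_strongly_continuous:
  fixes f :: "'m::metric_space \<Rightarrow> 'm" and A :: "'m \<Rightarrow> nat \<Rightarrow> 'x::banach \<Rightarrow>\<^sub>L 'x"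
  assumes M: "compact (UNIV :: 'm set)" and f: "continuous_on UNIV f" and A: "cocycle f A"
  shows "continuous_on UNIV (\<lambda>q. A q n x)"
proof (induction n)
  case 0
  then show ?case using A by (simp add: cocycle_def)
next
  case (Suc n)
  obtain a where a: "1 \<le> a" "\<And>q. norm (A q 1) \<le> a"
    using cocycle_generator_bounded[OF M A] by blast
  have fn: "continuous_on UNIV (f ^^ n)"
    by (induction n) (auto intro!: continuous_on_compose2[OF f])
  have gen: "continuous_on UNIV (\<lambda>q. A q 1 y)" for y
    using A by (simp add: cocycle_def)
  show ?case
    unfolding continuous_on_def
  proof (intro ballI)
    fix q :: 'm
    let ?g = "\<lambda>p. A ((f ^^ n) p) 1 (A p n x)" and ?y = "A q n x"
    have y: "((\<lambda>p. A p n x) \<longlongrightarrow> ?y) (at q)"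
      using Suc by (simp add: continuous_on_def)
    have lim1: "((\<lambda>p. A ((f ^^ n) p) 1 (A p n x - ?y)) \<longlongrightarrow> 0) (at q)"
    proof (rule Lim_null_comparison)
      show "\<forall>\<^sub>F p in at q. norm (A ((f ^^ n) p) 1 (A p n x - ?y)) \<le> a * norm (A p n x - ?y)"
        by (intro always_eventually allI order_trans[OF norm_blinfun] mult_right_mono a) simp
      show "((\<lambda>p. a * norm (A p n x - ?y)) \<longlongrightarrow> 0) (at q)"
        by (rule tendsto_eq_intros refl y | simp)+
    qed
    have "continuous_on UNIV (\<lambda>p. A ((f ^^ n) p) 1 ?y)"
      by (rule continuous_on_compose2[OF gen fn]) simp
    then have lim2: "((\<lambda>p. A ((f ^^ n) p) 1 ?y) \<longlongrightarrow> ?g q) (at q)"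
      by (simp add: continuous_on_def)
    have "(?g \<longlongrightarrow> ?g q) (at q)"
      using tendsto_add[OF lim1 lim2] by (simp add: blinfun.diff_right)
    moreover have "A p (Suc n) x = ?g p" for p
      using cocycle_add[OF A, of p 1 n] by simp
    ultimately show "((\<lambda>p. A p (Suc n) x) \<longlongrightarrow> A q (Suc n) x) (at q within UNIV)"
      by simp
  qed
qed

lemma norm_blinfun_le_iff:
  assumes "0 \<le> b"
  shows "norm F \<le> b \<longleftrightarrow> (\<forall>x. norm (blinfun_apply F x) \<le> b * norm x)"
  using assms by (meson norm_blinfun norm_blinfun_bound mult_right_mono norm_ge_zero order_trans)

text \<open>The operator norm is in general only lower semicontinuous here, being a supremum of
  continuous functions; this suffices for closed sublevel sets.\<close>

lemma closed_strongly_continuous_norm_le: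
  fixes F :: "'m::topological_space \<Rightarrow> 'x::real_normed_vector \<Rightarrow>\<^sub>L 'y::real_normed_vector"
  assumes "\<And>x. continuous_on UNIV (\<lambda>q. F q x)" "0 \<le> b"
  shows "closed {q. norm (F q) \<le> b}"
proof -
  have "{q. norm (F q) \<le> b} = (\<Inter>x. {q. norm (F q x) \<le> b * norm x})"
    using norm_blinfun_le_iff[OF assms(2)] by auto
  also have "closed \<dots>"
    by (intro closed_INT ballI closed_Collect_le continuous_intros assms)
  finally show ?thesis .
qed

lemma borel_measurable_norm_strongly_continuous:
  fixes F :: "'m::topological_space \<Rightarrow> 'x::real_normed_vector \<Rightarrow>\<^sub>L 'y::real_normed_vector"
  assumes "\<And>x. continuous_on UNIV (\<lambda>q. F q x)"
  shows "(\<lambda>q. norm (F q)) \<in> borel_measurable borel"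
  unfolding borel_measurable_iff_le
proof
  fix b :: real
  have "{q. norm (F q) \<le> b} \<in> sets borel"
  proof (cases "0 \<le> b")
    case True
    then show ?thesis by (intro borel_closed closed_strongly_continuous_norm_le assms)
  next
    case False
    then have "{q. norm (F q) \<le> b} = {}" by (auto dest: order_trans[OF norm_ge_zero])
    then show ?thesis by simp
  qed
  then show "{q \<in> space borel. norm (F q) \<le> b} \<in> sets borel" by simp
qed

section \<open>Growth sets and growth along orbits\<close>

lemma lyapunov_exponent_less_imp_bounded:
  assumes "(\<lambda>n. ereal (1 / real n) * ext_ln (norm (B n))) \<longlonglongrightarrow> l" "l < ereal L"
  obtains K :: nat where "\<And>n. norm (B n) \<le> exp (real K + L * real n)"
proof -
  have "eventually (\<lambda>n. ereal (1 / real n) * ext_ln (norm (B n)) < ereal L) sequentially"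
    using assms by (rule order_tendstoD(2))
  then obtain n0 where n0: "ereal (1 / real n) * ext_ln (norm (B n)) < ereal L" if "n \<ge> n0" for n
    by (auto simp: eventually_sequentially)
  \<comment> \<open>Index 0 is left out because \<open>1 / real 0\<close> is 0, so the bound cannot
    be multiplied through by \<open>n\<close>.\<close>
  have tail: "norm (B n) \<le> exp (L * real n)" if "n \<ge> Suc n0" for n
  proof (cases "norm (B n) = 0")
    case False
    then have "ln (norm (B n)) < L * real n"
      using n0[of n] that by (simp add: ext_ln_def field_simps)
    then have "exp (ln (norm (B n))) \<le> exp (L * real n)" by (subst exp_le_cancel_iff) simp
    with False show ?thesis by simp
  qed simp
  define s where "s = (\<Sum>n<Suc n0. norm (B n) * exp (- L * real n))"
  have head: "norm (B n) * exp (- L * real n) \<le> s" if "n < Suc n0" for n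
    unfolding s_def using that by (intro member_le_sum) auto
  \<comment> \<open>A natural \<open>K\<close> keeps the exhaustion by growth sets countable. The
    head is covered by \<open>s \<le> K \<le> exp K\<close>, the tail by
    \<open>1 \<le> exp K\<close>.\<close>
  obtain K :: nat where K: "s \<le> real K" using real_arch_simple by blast
  have "norm (B n) \<le> exp (real K + L * real n)" for n
  proof (cases "n < Suc n0")
    case True
    have "norm (B n) * exp (- L * real n) \<le> exp (real K)"
      using head[OF True] K exp_ge_add_one_self[of "real K"] by linarith
    then show ?thesis by (simp add: exp_add exp_minus field_simps)
  next
    case False
    then show ?thesis using tail[of n] by (intro order_trans[OF tail]) auto
  qed
  then show ?thesis by (rule that)
qed

definition growth_set :: "('m \<Rightarrow> nat \<Rightarrow> 'x::real_normed_vector \<Rightarrow>\<^sub>L 'x) \<Rightarrow> real \<Rightarrow> real \<Rightarrow> 'm set" where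
  "growth_set A L K = {q. \<forall>n. norm (A q n) \<le> exp (K + L * real n)}"

text \<open>Here \<open>C\<close> bounds the excess of one step over the rate \<open>L\<close>. If
  \<open>j \<le> n\<close>, the product splits at time \<open>j\<close> and only the first
  \<open>j\<close> steps pay; otherwise the crude bound costs \<open>C * n\<close>, below
  \<open>C * j\<close>.\<close>

lemma growth_set_preimage:
  assumes A: "cocycle f A" and a: "0 < a" "\<And>q. norm (A q 1) \<le> a"
    and C: "0 \<le> C" "a \<le> exp (C + L)" and K: "0 \<le> K"
    and q: "(f ^^ j) q \<in> growth_set A L K"
  shows "q \<in> growth_set A L (K + C * real j)"
  unfolding growth_set_def
proof (intro CollectI allI)
  fix n
  have pow: "norm (A q i) \<le> exp (C * real i + L * real i)" for i
  proof -
    have "norm (A q i) \<le> a ^ i" using cocycle_norm_le_power[OF A _ a(2)] a(1) by simp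
    also have "\<dots> \<le> exp (C + L) ^ i" using a C by (intro power_mono) auto
    finally show ?thesis by (simp add: exp_of_nat_mult[symmetric] algebra_simps)
  qed
  show "norm (A q n) \<le> exp (K + C * real j + L * real n)"
  proof (cases "j \<le> n")
    case True
    then obtain m where m: "n = m + j" using le_Suc_ex by (metis add.commute)
    have "norm (A q n) \<le> norm (A ((f ^^ j) q) m) * norm (A q j)"
      unfolding m cocycle_add[OF A] by (rule norm_blinfun_compose)
    also have "\<dots> \<le> exp (K + L * real m) * exp (C * real j + L * real j)"
      using q pow by (intro mult_mono) (auto simp: growth_set_def)
    finally show ?thesis by (simp add: m exp_add[symmetric] algebra_simps)
  next
    case False
    then have "C * real n \<le> C * real j" using C by (intro mult_left_mono) auto
    then show ?thesis using K by (intro order_trans[OF pow]) simp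
  qed
qed

text \<open>From time \<open>m\<close> a growth set is reached within \<open>c + m / k\<close>
  steps, at cost \<open>C\<close> per step. Choosing \<open>C / k \<le> \<epsilon>\<close> makes the
  part proportional to \<open>m\<close> at most \<open>\<epsilon> * m\<close>; the rest goes into
  \<open>b\<close>.\<close>

lemma AE_growth_along_orbit:
  fixes f :: "'m::topological_space \<Rightarrow> 'm"
  assumes M: "prob_space M" and f: "f \<in> M \<rightarrow>\<^sub>M M" and inv: "distr M M f = M"
    and A: "cocycle f A" and a: "0 < a" "\<And>q. norm (A q 1) \<le> a"
    and sets: "\<And>K. growth_set A L K \<in> sets M"
    and growth: "AE q in M. \<exists>K::nat. q \<in> growth_set A L K"
    and "0 < \<epsilon>"
  shows "AE q in M. \<exists>b. \<forall>m n. norm (A ((f ^^ m) q) n) \<le> exp (b + \<epsilon> * real m + L * real n)"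
proof -
  interpret prob_space M by (rule M)
  define C where "C = max 1 (ln a - L)"
  have C: "0 < C" "a \<le> exp (C + L)"
  proof -
    have "ln a \<le> C + L" by (simp add: C_def)
    then show "a \<le> exp (C + L)" using a(1) by (metis exp_le_cancel_iff exp_ln)
  qed (simp add: C_def)
  obtain k0 :: nat where k0: "C / \<epsilon> \<le> real k0" using real_arch_simple by blast
  define k where "k = Suc k0"
  have k: "0 < k" "C / real k \<le> \<epsilon>"
    using k0 \<open>0 < \<epsilon>\<close> by (auto simp: k_def field_simps)
  \<comment> \<open>The index \<open>K\<close> depends on the point, so the return estimate must
    hold for all \<open>K\<close> off a single null set.\<close>
  have "AE q in M. \<forall>K::nat. q \<in> growth_set A L K \<longrightarrow>
      (\<exists>c. \<forall>n. \<exists>j \<le> c + n div k. (f ^^ (n + j)) q \<in> growth_set A L K)"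
    unfolding AE_all_countable by (intro allI AE_sublinear_return f inv sets k)
  with growth show ?thesis
  proof eventually_elim
    case (elim q)
    then obtain K c :: nat
      where c: "\<And>m. \<exists>j \<le> c + m div k. (f ^^ (m + j)) q \<in> growth_set A L K"
      by blast
    have "norm (A ((f ^^ m) q) n) \<le> exp (K + C * c + \<epsilon> * real m + L * real n)" for m n
    proof -
      obtain j where j: "j \<le> c + m div k" "(f ^^ (m + j)) q \<in> growth_set A L K"
        using c by blast
      have "(f ^^ j) ((f ^^ m) q) \<in> growth_set A L K"
        using j(2) by (simp add: funpow_add add.commute[of m])
      then have "(f ^^ m) q \<in> growth_set A L (K + C * real j)"
        using C by (intro growth_set_preimage[OF A a]) auto
      then have "norm (A ((f ^^ m) q) n) \<le> exp (K + C * real j + L * real n)"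
        by (simp add: growth_set_def)
      moreover have "C * real j \<le> C * c + \<epsilon> * real m"
      proof -
        have "real j \<le> real c + real m / real k"
          using j(1) of_nat_div_le_of_nat[of m k, where ?'a = real] by linarith
        then have "C * real j \<le> C * (real c + real m / real k)"
          using C by (intro mult_left_mono) auto
        also have "\<dots> = C * c + C / real k * real m" by (simp add: algebra_simps)
        also have "\<dots> \<le> C * c + \<epsilon> * real m"
          using k by (intro add_left_mono mult_right_mono) auto
        finally show ?thesis .
      qed
      ultimately show ?thesis by (elim order_trans) simp
    qed
    then show ?case by blast
  qed
qed

section \<open>Construction of the function \<open>T\<close>\<close>

theorem theorem2:
  fixes f :: "'m::metric_space \<Rightarrow> 'm"
    and A :: "'m \<Rightarrow> nat \<Rightarrow> 'x::{banach, second_countable_topology} \<Rightarrow>\<^sub>L 'x"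
    and \<mu> :: "'m measure"
    and \<Lambda> :: ereal
  assumes "compact (UNIV :: 'm set)"
    and "continuous_on UNIV f"
    and "cocycle f A"
    and "prob_space \<mu>" and "sets \<mu> = sets borel"
    and "ergodic_invariant f \<mu>"
    and "has_largest_lyapunov_exponent \<mu> A \<Lambda>"
    and "\<Lambda> < 0"
  shows "\<forall>\<epsilon>>0. \<forall>L::real. \<Lambda> + ereal \<epsilon> \<le> ereal L \<longrightarrow>
    (\<exists>T :: 'm \<Rightarrow> real. T \<in> borel_measurable borel \<and> (\<forall>q. 0 < T q) \<and>
       (AE q in \<mu>. \<forall>n. norm (A q n) \<le> T q * exp (L * real n)) \<and>
       (AE q in \<mu>. \<forall>n. T ((f ^^ n) q) \<le> T q * exp (\<epsilon> * real n)))"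
proof (intro allI impI)
  fix \<epsilon> L :: real
  assume \<epsilon>: "0 < \<epsilon>" and L: "\<Lambda> + ereal \<epsilon> \<le> ereal L"
  note M = assms(1) and f = assms(2) and A = assms(3) and sets_eq = assms(5)
  interpret prob_space \<mu> by fact
  have space_eq: "space \<mu> = UNIV" using sets_eq_imp_space_eq[OF sets_eq] by simp
  have f_inv: "f \<in> \<mu> \<rightarrow>\<^sub>M \<mu>" "distr \<mu> \<mu> f = \<mu>"
    using assms(6) by (auto simp: ergodic_invariant_def)
  have cont: "continuous_on UNIV (\<lambda>q. A q n x)" for n x
    by (rule cocycle_strongly_continuous[OF M f A])
  obtain a where a: "1 \<le> a" "\<And>q. norm (A q 1) \<le> a"
    using cocycle_generator_bounded[OF M A] by blast
  have "\<Lambda> < ereal L"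
    using L \<epsilon> assms(8) by (cases \<Lambda>) auto
  have growth_sets: "growth_set A L K \<in> sets \<mu>" for K
  proof -
    have "growth_set A L K = (\<Inter>n. {q. norm (A q n) \<le> exp (K + L * real n)})"
      by (auto simp: growth_set_def)
    also have "closed \<dots>"
      by (intro closed_INT ballI closed_strongly_continuous_norm_le cont) simp
    finally show ?thesis by (simp add: sets_eq borel_closed)
  qed
  have "AE q in \<mu>. (\<lambda>n. ereal (1 / real n) * ext_ln (norm (A q n))) \<longlonglongrightarrow> \<Lambda>"
    using assms(7) by (simp add: has_largest_lyapunov_exponent_def)
  then have growth: "AE q in \<mu>. \<exists>K::nat. q \<in> growth_set A L K"
  proof eventually_elim
    case (elim q)
    show ?case
      using lyapunov_exponent_less_imp_bounded[OF elim \<open>\<Lambda> < ereal L\<close>]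
      by (auto simp: growth_set_def)
  qed
  define w where "w q m n = norm (A ((f ^^ m) q) n) * exp (- L * real n - \<epsilon> * real m)" for q m n
  have w_nonneg: "0 \<le> w q m n" for q m n by (simp add: w_def)
  \<comment> \<open>In \<open>ennreal\<close> the supremum always exists, so the shift estimate
    below holds at every point, finite or not.\<close>
  define S where "S q = (SUP m. SUP n. ennreal (w q m n))" for q
  have le_S: "ennreal (w q m n) \<le> S q" for q m n
    unfolding S_def by (meson SUP_upper2 UNIV_I order_refl)
  have finite: "AE q in \<mu>. S q < \<infinity>"
  proof -
    have "AE q in \<mu>. \<exists>b. \<forall>m n. norm (A ((f ^^ m) q) n) \<le> exp (b + \<epsilon> * real m + L * real n)"
      using a \<epsilon> by (intro AE_growth_along_orbit[OF prob_space_axioms f_inv A _ a(2)] growth_sets growth) auto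
    then show ?thesis
    proof eventually_elim
      case (elim q)
      then obtain b where b: "\<And>m n. norm (A ((f ^^ m) q) n) \<le> exp (b + \<epsilon> * real m + L * real n)"
        by blast
      have "w q m n \<le> exp b" for m n
        using mult_right_mono[OF b, of "exp (- L * real n - \<epsilon> * real m)" m n]
        by (simp add: w_def flip: exp_add)
      then have "S q \<le> ennreal (exp b)"
        unfolding S_def by (intro SUP_least ennreal_leI)
      then show ?case by (simp add: le_less_trans)
    qed
  qed
  \<comment> \<open>Moving the base point by \<open>i\<close> replaces \<open>m\<close> by
    \<open>m + i\<close>, which changes the weight by exactly
    \<open>exp (\<epsilon> * i)\<close>.\<close>
  have shift: "S ((f ^^ i) q) \<le> S q * ennreal (exp (\<epsilon> * real i))" for i q
    unfolding S_def[of "(f ^^ i) q"]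
  proof (intro SUP_least)
    fix m n
    have "w ((f ^^ i) q) m n = w q (m + i) n * exp (\<epsilon> * real i)"
      unfolding w_def funpow_add o_apply mult.assoc exp_add[symmetric] by (simp add: algebra_simps)
    then have "ennreal (w ((f ^^ i) q) m n) = ennreal (w q (m + i) n) * ennreal (exp (\<epsilon> * real i))"
      by (simp add: ennreal_mult w_nonneg)
    also have "\<dots> \<le> S q * ennreal (exp (\<epsilon> * real i))"
      by (intro mult_right_mono le_S) simp
    finally show "ennreal (w ((f ^^ i) q) m n) \<le> S q * ennreal (exp (\<epsilon> * real i))" .
  qed
  text \<open>The lower bound \<open>1\<close> makes \<open>T\<close> positive when \<open>S\<close> vanishes, that is, on the zero space.\<close>
  define T where "T q = (if S q = \<infinity> then 1 else max 1 (enn2real (S q)))" for q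
  have "S \<in> borel_measurable borel"
  proof -
    have [measurable]: "f \<in> borel \<rightarrow>\<^sub>M borel"
      using f by (rule borel_measurable_continuous_onI)
    have [measurable]: "(\<lambda>q. norm (A q n)) \<in> borel_measurable borel" for n
      by (intro borel_measurable_norm_strongly_continuous cont)
    have [measurable]: "(\<lambda>q. norm (A ((f ^^ m) q) n)) \<in> borel_measurable borel" for m n
      by (rule measurable_compose[of "f ^^ m" borel borel]) measurable
    show ?thesis unfolding S_def w_def by measurable
  qed
  then have "T \<in> borel_measurable borel"
    unfolding T_def by measurable
  moreover have "0 < T q" for q
    by (simp add: T_def less_max_iff_disj)
  moreover have "AE q in \<mu>. \<forall>n. norm (A q n) \<le> T q * exp (L * real n)"
    using finite
  proof eventually_elim
    case (elim q)
    then have "w q 0 n \<le> T q" for n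
      using enn2real_mono[OF le_S[of q 0 n]] w_nonneg[of q 0 n] by (auto simp: T_def le_max_iff_disj)
    then show ?case by (simp add: w_def exp_minus field_simps)
  qed
  moreover have "AE q in \<mu>. \<forall>n. T ((f ^^ n) q) \<le> T q * exp (\<epsilon> * real n)"
    using finite
  proof eventually_elim
    case (elim q)
    show ?case
    proof
      fix n
      \<comment> \<open>Finiteness of \<open>S\<close> propagates along the orbit, so the default
        branch of \<open>T\<close> is never met there. The floor 1 survives because the factor
        \<open>exp (\<epsilon> * n)\<close> is at least 1.\<close>
      have "S q * ennreal (exp (\<epsilon> * real n)) < \<infinity>"
        using elim by (simp add: ennreal_mult_less_top)
      then have "S ((f ^^ n) q) < \<infinity>" "enn2real (S ((f ^^ n) q)) \<le> enn2real (S q) * exp (\<epsilon> * real n)"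
        using shift[of n q] enn2real_mono[OF shift[of n q]]
        by (auto simp: enn2real_mult intro: le_less_trans)
      moreover have "1 \<le> exp (\<epsilon> * real n)" using \<epsilon> by simp
      moreover have "max 1 (enn2real (S q)) * exp (\<epsilon> * real n) =
          max (exp (\<epsilon> * real n)) (enn2real (S q) * exp (\<epsilon> * real n))"
        by (simp add: max_mult_distrib_right)
      ultimately show "T ((f ^^ n) q) \<le> T q * exp (\<epsilon> * real n)"
        using elim by (auto simp: T_def le_max_iff_disj)
    qed
  qed
  ultimately show "\<exists>T :: 'm \<Rightarrow> real. T \<in> borel_measurable borel \<and> (\<forall>q. 0 < T q) \<and>
       (AE q in \<mu>. \<forall>n. norm (A q n) \<le> T q * exp (L * real n)) \<and>
       (AE q in \<mu>. \<forall>n. T ((f ^^ n) q) \<le> T q * exp (\<epsilon> * real n))"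
    by blast
qed

end
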